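(* Let $(Z,\sigma,\kappa)$ be a weighted dual skeleton with $k$ non-trivial pairs, and let $A_\nu:Z\to\mathbb R$ ($\nu=1,\dots,N$) be amplitudes making it a complete spectral duality structure (so the vectors $\mathbf A(z)=(A_1(z),\dots,A_N(z))\in\mathbb R^N$, $z\in Z$, are linearly independent). Let $f_1,\dots,f_N:(0,1)\to\mathbb R$ be spectral functions such that $s_z(\gamma)>0$ for all $z\in Z$, $\gamma\in(0,1)$, and let $\pi^\ast$ be a neutral distribution in the interior of the simplex. Assume in addition that $f_1,\dots,f_N$ are linearly independent as functions on $(0,1)$. Then the response rank satisfies $$r_{\mathrm{resp}}=k.$$
   Context: A weighted dual skeleton is a triple $(Z,\sigma,\kappa)$ where $Z$ is a non-empty finite set, $\sigma:Z\to Z$ satisfies $\sigma^2=\mathrm{id}$, and $\kappa:Z\to\mathbb R_{>0}$ satisfies $\kappa(z)\kappa(\sigma(z))=K$ for all $z$, with $K>0$ constant. A non-trivial pair is an orbit $\{z,\sigma(z)\}$ with $\sigma(z)\neq z$. Put $C^\ast=1/(1+\sqrt K)$ and $r_z=(\kappa(\sigma(z))/\kappa(z))^{1/2}$. A complete spectral duality structure is a skeleton together with functions $A_\nu:Z\to\mathbb R$, $\nu=1,\dots,N$ (amplitudes), such that the $|Z|$ vectors $\mathbf A(z)=(A_1(z),\dots,A_N(z))\in\mathbb R^N$ are linearly independent; the dual functions are $B_\nu(z)=\kappa(z)A_\nu(\sigma(z))$. Given $f_1,\dots,f_N:(0,1)\to\mathbb R$, set $$u_z(\gamma)=\sum_{\nu=1}^N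 f_\nu(\gamma)A_\nu(z),\qquad s_z(\gamma)=\sum_{\nu=1}^N f_\nu(\gamma)[A_\nu(z)+B_\nu(z)]=u_z(\gamma)+\kappa(z)u_{\sigma(z)}(\gamma),$$ and $\langle\pi,x\rangle=\sum_{z\in Z}\pi_zx_z$. A probability vector $\pi$ on $Z$ is neutral if $\pi_z/\pi_{\sigma(z)}=r_z$ for every $z$, equivalently $\sqrt{\kappa(z)}\,\pi_z=\sqrt{\kappa(\sigma(z))}\,\pi_{\sigma(z)}$ for every $z$. "Interior of the simplex" means all $\pi^\ast_z>0$. The response covector at $\pi^\ast$ is the vector $$\psi(\gamma)=\frac{u(\gamma)-C^\ast s(\gamma)}{\langle\pi^\ast,s(\gamma)\rangle}\in\mathbb R^Z,$$ which represents, on tangent vectors $x$ with $\sum_zx_z=0$, the differential at $\pi^\ast$ of the coupling functional $C(\pi,\gamma)=\langle\pi,u(\gamma)\rangle/\langle\pi,s(\gamma)\rangle$. The response rank is $r_{\mathrm{resp}}=\dim\operatorname{span}\{\psi(\gamma):\gamma\in(0,1)\}$, computed in $\mathbb R^Z$. *)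

theory Defs
  imports "HOL-Analysis.Analysis"
begin

text \<open>
  The finite non-empty set $Z$ is the universe of a type \<open>'z :: finite\<close>, the index set
  $\{1,\dots,N\}$ is the universe of a type \<open>'n :: finite\<close>, so $\mathbf R^Z$ and
  $\mathbf R^N$ are \<open>real^'z\<close> and \<open>real^'n\<close>. (The case $N = 0$ cannot occur in a complete
  structure, because $Z$ is non-empty and the amplitude vectors are independent.)
  Functions on $(0,1)$ are functions on \<open>real\<close> that are only ever evaluated on
  \<open>{0<..<1}\<close>.
\<close>

definition weighted_dual_skeleton ::
    "('z::finite \<Rightarrow> 'z) \<Rightarrow> ('z \<Rightarrow> real) \<Rightarrow> real \<Rightarrow> bool" where
  "weighted_dual_skeleton \<sigma> \<kappa> K \<longleftrightarrow>
     (\<forall>z. \<sigma> (\<sigma> z) = z) \<and> (\<forall>z. \<kappa> z > 0) \<and> K > 0 \<and> (\<forall>z. \<kappa> z * \<kappa> (\<sigma> z) = K)"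

definition nontrivial_pairs :: "('z::finite \<Rightarrow> 'z) \<Rightarrow> 'z set set" where
  "nontrivial_pairs \<sigma> = {{z, \<sigma> z} | z. \<sigma> z \<noteq> z}"

definition C_star :: "real \<Rightarrow> real" where
  "C_star K = 1 / (1 + sqrt K)"

definition ratio :: "('z::finite \<Rightarrow> 'z) \<Rightarrow> ('z \<Rightarrow> real) \<Rightarrow> 'z \<Rightarrow> real" where
  "ratio \<sigma> \<kappa> z = sqrt (\<kappa> (\<sigma> z) / \<kappa> z)"

definition amplitude_vector :: "('n::finite \<Rightarrow> 'z \<Rightarrow> real) \<Rightarrow> 'z \<Rightarrow> real^'n" where
  "amplitude_vector A z = (\<chi> \<nu>. A \<nu> z)"

text \<open>Independence is that of the family indexed by $Z$, hence the injectivity.\<close>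

definition complete_spectral_duality_structure ::
    "('z::finite \<Rightarrow> 'z) \<Rightarrow> ('z \<Rightarrow> real) \<Rightarrow> real \<Rightarrow> ('n::finite \<Rightarrow> 'z \<Rightarrow> real) \<Rightarrow> bool" where
  "complete_spectral_duality_structure \<sigma> \<kappa> K A \<longleftrightarrow>
     weighted_dual_skeleton \<sigma> \<kappa> K \<and>
     inj (amplitude_vector A) \<and> independent (range (amplitude_vector A))"

definition dual_amplitude ::
    "('z::finite \<Rightarrow> 'z) \<Rightarrow> ('z \<Rightarrow> real) \<Rightarrow> ('n::finite \<Rightarrow> 'z \<Rightarrow> real) \<Rightarrow> 'n \<Rightarrow> 'z \<Rightarrow> real" where
  "dual_amplitude \<sigma> \<kappa> A \<nu> z = \<kappa> z * A \<nu> (\<sigma> z)"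

definition u_vec ::
    "('n::finite \<Rightarrow> 'z::finite \<Rightarrow> real) \<Rightarrow> ('n \<Rightarrow> real \<Rightarrow> real) \<Rightarrow> real \<Rightarrow> real^'z" where
  "u_vec A f \<gamma> = (\<chi> z. \<Sum>\<nu>\<in>UNIV. f \<nu> \<gamma> * A \<nu> z)"

definition s_vec ::
    "('z::finite \<Rightarrow> 'z) \<Rightarrow> ('z \<Rightarrow> real) \<Rightarrow> ('n::finite \<Rightarrow> 'z \<Rightarrow> real) \<Rightarrow>
     ('n \<Rightarrow> real \<Rightarrow> real) \<Rightarrow> real \<Rightarrow> real^'z" where
  "s_vec \<sigma> \<kappa> A f \<gamma> = (\<chi> z. \<Sum>\<nu>\<in>UNIV. f \<nu> \<gamma> * (A \<nu> z + dual_amplitude \<sigma> \<kappa> A \<nu> z))"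

definition probability_vector :: "real^'z::finite \<Rightarrow> bool" where
  "probability_vector \<pi> \<longleftrightarrow> (\<forall>z. \<pi> $ z \<ge> 0) \<and> (\<Sum>z\<in>UNIV. \<pi> $ z) = 1"

definition neutral :: "('z::finite \<Rightarrow> 'z) \<Rightarrow> ('z \<Rightarrow> real) \<Rightarrow> real^'z \<Rightarrow> bool" where
  "neutral \<sigma> \<kappa> \<pi> \<longleftrightarrow>
     probability_vector \<pi> \<and> (\<forall>z. \<pi> $ z / \<pi> $ (\<sigma> z) = ratio \<sigma> \<kappa> z)"

definition linearly_independent_on ::
    "real set \<Rightarrow> ('n::finite \<Rightarrow> real \<Rightarrow> real) \<Rightarrow> bool" where
  "linearly_independent_on I f \<longleftrightarrow>
     (\<forall>c. (\<forall>\<gamma>\<in>I. (\<Sum>\<nu>\<in>UNIV. c \<nu> * f \<nu> \<gamma>) = 0) \<longrightarrow> (\<forall>\<nu>. c \<nu> = 0))"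

text \<open>The pairing $\langle\pi,x\rangle = \sum_z \pi_z x_z$ is the inner product of \<open>real^'z\<close>.\<close>

definition response_covector ::
    "('z::finite \<Rightarrow> 'z) \<Rightarrow> ('z \<Rightarrow> real) \<Rightarrow> real \<Rightarrow> ('n::finite \<Rightarrow> 'z \<Rightarrow> real) \<Rightarrow>
     ('n \<Rightarrow> real \<Rightarrow> real) \<Rightarrow> real^'z \<Rightarrow> real \<Rightarrow> real^'z" where
  "response_covector \<sigma> \<kappa> K A f \<pi> \<gamma> =
     (u_vec A f \<gamma> - C_star K *\<^sub>R s_vec \<sigma> \<kappa> A f \<gamma>) /\<^sub>R (\<pi> \<bullet> s_vec \<sigma> \<kappa> A f \<gamma>)"

definition response_rank ::
    "('z::finite \<Rightarrow> 'z) \<Rightarrow> ('z \<Rightarrow> real) \<Rightarrow> real \<Rightarrow> ('n::finite \<Rightarrow> 'z \<Rightarrow> real) \<Rightarrow>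
     ('n \<Rightarrow> real \<Rightarrow> real) \<Rightarrow> real^'z \<Rightarrow> nat" where
  "response_rank \<sigma> \<kappa> K A f \<pi> = dim (span (response_covector \<sigma> \<kappa> K A f \<pi> ` {0<..<1}))"

end

theory Submission
  imports Defs
begin

text \<open>
  Since $1 - C^\ast = C^\ast\sqrt K$, the numerator $u - C^\ast s$ of the response covector is
  the image of $u$ under the fixed linear map
  $(Tx)_z = C^\ast(\sqrt K\,x_z - \kappa(z)\,x_{\sigma(z)})$ (\<open>duality_defect\<close>), and the
  denominator is a positive scalar.  So the response covectors span the image under $T$ of the span
  of the vectors $u(\gamma)$, and two facts remain.

  The vectors $u(\gamma)$ span all of $\mathbf R^Z$ (\<open>span_u_vec\<close>): for a vector $v$
  orthogonal to all of them, $\langle v, u(\gamma)\rangle = 0$ is a linear relation between the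
  $f_\nu$ with coefficients $\sum_z v_z A_\nu(z)$; these vanish because the $f_\nu$ are
  independent, and then $v = 0$ because the amplitude vectors are independent.

  The rank of $T$ is the number of non-trivial pairs (\<open>dim_range_duality_defect\<close>).  At a
  fixed point of $\sigma$ we have $\kappa(z) = \sqrt K$, so $T$ is zero there.  On a non-trivial
  pair, $T$ acts by a two-by-two matrix with determinant
  ${C^\ast}^2(K - \kappa(z)\kappa(\sigma(z))) = 0$ and non-zero diagonal, so it contributes exactly
  one dimension.
\<close>

definition duality_defect ::
    "('z::finite \<Rightarrow> 'z) \<Rightarrow> ('z \<Rightarrow> real) \<Rightarrow> real \<Rightarrow> real^'z \<Rightarrow> real^'z" where
  "duality_defect \<sigma> \<kappa> K x = (\<chi> z. C_star K * (sqrt K * x $ z - \<kappa> z * x $ \<sigma> z))"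

lemma linear_duality_defect: "linear (duality_defect \<sigma> \<kappa> K)"
  by (rule linearI) (auto simp: duality_defect_def vec_eq_iff algebra_simps)

lemma s_vec_nth: "s_vec \<sigma> \<kappa> A f \<gamma> $ z = u_vec A f \<gamma> $ z + \<kappa> z * u_vec A f \<gamma> $ \<sigma> z"
  by (simp add: s_vec_def u_vec_def dual_amplitude_def algebra_simps sum.distrib sum_distrib_left)

lemma u_vec_minus_s_vec_eq_duality_defect:
  assumes "K > 0"
  shows "u_vec A f \<gamma> - C_star K *\<^sub>R s_vec \<sigma> \<kappa> A f \<gamma> = duality_defect \<sigma> \<kappa> K (u_vec A f \<gamma>)"
proof -
  have "1 + sqrt K \<noteq> 0"
    using assms by (smt (verit) real_sqrt_gt_zero)
  then have c: "C_star K * sqrt K = 1 - C_star K"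
    by (simp add: C_star_def field_simps)
  have "a - C_star K * (a + b) = C_star K * (sqrt K * a - b)" for a b
  proof -
    have "C_star K * (sqrt K * a - b) = (C_star K * sqrt K) * a - C_star K * b"
      by (simp add: algebra_simps)
    then show ?thesis
      by (simp add: c algebra_simps)
  qed
  then show ?thesis
    by (simp add: vec_eq_iff s_vec_nth duality_defect_def)
qed

lemma span_nonzero_scaled_image:
  fixes g :: "'i \<Rightarrow> 'a::real_vector"
  assumes "\<And>i. i \<in> I \<Longrightarrow> c i \<noteq> 0"
  shows "span ((\<lambda>i. c i *\<^sub>R g i) ` I) = span (g ` I)"
proof -
  have "g i \<in> span ((\<lambda>i. c i *\<^sub>R g i) ` I)" if "i \<in> I" for i
  proof -
    have "inverse (c i) *\<^sub>R (c i *\<^sub>R g i) \<in> span ((\<lambda>i. c i *\<^sub>R g i) ` I)"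
      using that by (intro span_scale span_base) auto
    then show ?thesis
      using assms[OF that] by simp
  qed
  moreover have "c i *\<^sub>R g i \<in> span (g ` I)" if "i \<in> I" for i
    using that by (intro span_scale span_base) auto
  ultimately show ?thesis
    by (simp add: span_eq image_subset_iff)
qed

lemma independent_family_vanishing_combination:
  fixes a :: "'z::finite \<Rightarrow> 'a::real_vector"
  assumes "inj a" "independent (range a)" "(\<Sum>z\<in>UNIV. v z *\<^sub>R a z) = 0"
  shows "v z = 0"
proof -
  have "(\<Sum>x\<in>range a. v (inv a x) *\<^sub>R x) = 0"
    using assms by (simp add: sum.reindex)
  then have "v (inv a (a z)) = 0"
    by (intro independentD[OF assms(2), of "range a"]) auto
  then show ?thesis
    using assms(1) by simp
qed

lemma span_u_vec:
  assumes inj: "inj (amplitude_vector A)"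
    and indep: "independent (range (amplitude_vector A))"
    and f: "linearly_independent_on I f"
  shows "span (u_vec A f ` I) = UNIV"
proof (rule ccontr)
  assume "span (u_vec A f ` I) \<noteq> UNIV"
  then obtain v where "v \<noteq> 0" and v: "\<And>x. x \<in> span (u_vec A f ` I) \<Longrightarrow> v \<bullet> x = 0"
    using span_not_UNIV_orthogonal by blast
  have "(\<Sum>\<nu>\<in>UNIV. (\<Sum>z\<in>UNIV. v $ z * A \<nu> z) * f \<nu> \<gamma>) = v \<bullet> u_vec A f \<gamma>" for \<gamma>
    unfolding inner_vec_def u_vec_def
    by (simp add: sum_distrib_left sum_distrib_right mult.assoc)
       (subst sum.swap, simp add: mult_ac)
  then have "\<forall>\<gamma>\<in>I. (\<Sum>\<nu>\<in>UNIV. (\<Sum>z\<in>UNIV. v $ z * A \<nu> z) * f \<nu> \<gamma>) = 0"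
    using v by (auto intro: span_base)
  then have "(\<Sum>z\<in>UNIV. v $ z * A \<nu> z) = 0" for \<nu>
    using f[unfolded linearly_independent_on_def, rule_format,
        of "\<lambda>\<nu>. \<Sum>z\<in>UNIV. v $ z * A \<nu> z"] by blast
  then have "(\<Sum>z\<in>UNIV. v $ z *\<^sub>R amplitude_vector A z) = 0"
    by (simp add: vec_eq_iff amplitude_vector_def)
  then have "v $ z = 0" for z
    using independent_family_vanishing_combination[OF inj indep] by blast
  then show False
    using \<open>v \<noteq> 0\<close> by (simp add: vec_eq_iff)
qed

text \<open>
  A set $S$ of representatives of the non-trivial pairs cuts the source down to one free coordinate per pair; on
  vectors supported in $S$ the partner term drops out and $T$ is multiplication by the non-zero
  number $C^\ast\sqrt K$ at the points of $S$, so it is injective there.  Such vectors already give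
  the whole image: a vector $x$ may be replaced by the one with entries
  $x_z - \kappa(z)x_{\sigma(z)}/\sqrt K$ on $S$, and the entries of the image outside $S$ then agree
  because $\kappa(z)\kappa(\sigma(z)) = K$.
\<close>

lemma dim_range_duality_defect:
  assumes "weighted_dual_skeleton \<sigma> \<kappa> K"
  shows "dim (range (duality_defect \<sigma> \<kappa> K)) = card (nontrivial_pairs \<sigma>)"
proof -
  have invol: "\<sigma> (\<sigma> z) = z" and pos: "\<kappa> z > 0" and K: "K > 0" and prod: "\<kappa> z * \<kappa> (\<sigma> z) = K" for z
    using assms by (auto simp: weighted_dual_skeleton_def)
  define T where "T = duality_defect \<sigma> \<kappa> K"
  have T: "T x $ z = C_star K * (sqrt K * x $ z - \<kappa> z * x $ \<sigma> z)" for x z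
    by (simp add: T_def duality_defect_def)
  have "linear T"
    by (simp add: T_def linear_duality_defect)
  have "sqrt K > 0" and [simp]: "sqrt K * sqrt K = K"
    using K by auto
  then have c: "C_star K > 0"
    by (simp add: C_star_def add_pos_pos)
  have "nontrivial_pairs \<sigma> = (\<lambda>z. {z, \<sigma> z}) ` {z. \<sigma> z \<noteq> z}"
    by (auto simp: nontrivial_pairs_def)
  then obtain S where S: "S \<subseteq> {z. \<sigma> z \<noteq> z}" and inj: "inj_on (\<lambda>z. {z, \<sigma> z}) S"
      and pairs: "nontrivial_pairs \<sigma> = (\<lambda>z. {z, \<sigma> z}) ` S"
    using subset_image_inj[of "nontrivial_pairs \<sigma>"] by (metis (no_types, lifting) order_refl)
  have S_partner: "\<sigma> z \<notin> S" if "z \<in> S" for z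
  proof
    assume "\<sigma> z \<in> S"
    moreover have "{\<sigma> z, \<sigma> (\<sigma> z)} = {z, \<sigma> z}"
      using invol by auto
    ultimately have "\<sigma> z = z"
      using inj that by (auto dest: inj_onD)
    then show False
      using S that by auto
  qed
  have S_cover: "z \<in> S \<or> \<sigma> z \<in> S" if "\<sigma> z \<noteq> z" for z
  proof -
    have "{z, \<sigma> z} \<in> (\<lambda>z. {z, \<sigma> z}) ` S"
      using that pairs by (auto simp: nontrivial_pairs_def)
    then obtain y where "y \<in> S" "{z, \<sigma> z} = {y, \<sigma> y}"
      by blast
    then show ?thesis
      by (auto simp: doubleton_eq_iff)
  qed
  define V :: "(real^'a) set" where "V = {x. \<forall>z. z \<notin> S \<longrightarrow> x $ z = 0}"
  have "subspace V"
    by (auto simp: V_def subspace_def)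
  have T_fixed: "T x $ z = 0" if "\<sigma> z = z" for x z
  proof -
    have "\<kappa> z = sqrt K"
      using prod[of z] pos[of z] that by (intro real_sqrt_unique[symmetric]) (auto simp: power2_eq_square)
    then show ?thesis
      by (simp add: T that)
  qed
  have T_S: "T x $ z = C_star K * sqrt K * x $ z" if "x \<in> V" "z \<in> S" for x z
    using that S_partner by (simp add: T V_def)
  have "inj_on T V"
  proof (rule inj_onI)
    fix x y assume xy: "x \<in> V" "y \<in> V" "T x = T y"
    have "x $ z = y $ z" for z
    proof (cases "z \<in> S")
      case True
      then show ?thesis
        using T_S[of x z] T_S[of y z] xy c \<open>sqrt K > 0\<close> by simp
    next
      case False
      then show ?thesis
        using xy by (simp add: V_def)
    qed
    then show "x = y"
      by (simp add: vec_eq_iff)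
  qed
  have "T x \<in> T ` V" for x
  proof
    define y :: "real^'a" where
      "y = (\<chi> z. if z \<in> S then x $ z - \<kappa> z * x $ \<sigma> z / sqrt K else 0)"
    show "y \<in> V"
      by (simp add: V_def y_def)
    have "T x $ z = T y $ z" for z
    proof -
      consider "\<sigma> z = z" | "z \<in> S" | "\<sigma> z \<in> S"
        using S_cover by blast
      then show ?thesis
      proof cases
        case 1
        then show ?thesis
          by (simp add: T_fixed)
      next
        case 2
        then show ?thesis
          using S_partner[of z] \<open>sqrt K > 0\<close> by (simp add: T y_def field_simps)
      next
        case 3
        then have "z \<notin> S"
          using S_partner by blast
        have "\<kappa> z * (\<kappa> (\<sigma> z) * x $ z / sqrt K) = (\<kappa> z * \<kappa> (\<sigma> z)) / sqrt K * x $ z"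
          by simp
        also have "\<dots> = sqrt K * x $ z"
          using K by (simp add: prod real_div_sqrt)
        finally show ?thesis
          using 3 \<open>z \<notin> S\<close> by (simp add: T y_def invol right_diff_distrib)
      qed
    qed
    then show "T x = T y"
      by (simp add: vec_eq_iff)
  qed
  then have "range T = T ` V"
    by auto
  moreover have "dim (T ` V) = dim V"
    using \<open>linear T\<close> \<open>inj_on T V\<close> \<open>subspace V\<close>
    by (intro dim_image_eq) (simp_all add: span_eq_iff[THEN iffD2])
  moreover have "dim V = card S"
    unfolding V_def dim_vec_eq[symmetric] by (rule dim_substandard_cart)
  ultimately show ?thesis
    using card_image[OF inj] by (simp add: T_def pairs)
qed

theorem theorem8p8:
  fixes \<sigma> :: "'z::finite \<Rightarrow> 'z" and \<kappa> :: "'z \<Rightarrow> real" and K :: real and k :: nat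
    and A :: "'n::finite \<Rightarrow> 'z \<Rightarrow> real" and f :: "'n \<Rightarrow> real \<Rightarrow> real"
    and \<pi> :: "real^'z"
  assumes "complete_spectral_duality_structure \<sigma> \<kappa> K A"
    and "card (nontrivial_pairs \<sigma>) = k"
    and "\<And>z \<gamma>. \<gamma> \<in> {0<..<1} \<Longrightarrow> s_vec \<sigma> \<kappa> A f \<gamma> $ z > 0"
    and "neutral \<sigma> \<kappa> \<pi>"
    and "\<And>z. \<pi> $ z > 0"
    and "linearly_independent_on {0<..<1} f"
  shows "response_rank \<sigma> \<kappa> K A f \<pi> = k"
proof -
  have skel: "weighted_dual_skeleton \<sigma> \<kappa> K" and inj: "inj (amplitude_vector A)"
    and indep: "independent (range (amplitude_vector A))"
    using assms(1) by (auto simp: complete_spectral_duality_structure_def)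
  then have K: "K > 0"
    by (simp add: weighted_dual_skeleton_def)
  let ?T = "duality_defect \<sigma> \<kappa> K"
  have denom: "inverse (\<pi> \<bullet> s_vec \<sigma> \<kappa> A f \<gamma>) \<noteq> 0" if "\<gamma> \<in> {0<..<1}" for \<gamma>
  proof -
    have "\<pi> \<bullet> s_vec \<sigma> \<kappa> A f \<gamma> > 0"
      unfolding inner_vec_def using assms(3)[OF that] assms(5)
      by (intro sum_pos) auto
    then show ?thesis
      by simp
  qed
  have "response_covector \<sigma> \<kappa> K A f \<pi> =
      (\<lambda>\<gamma>. inverse (\<pi> \<bullet> s_vec \<sigma> \<kappa> A f \<gamma>) *\<^sub>R ?T (u_vec A f \<gamma>))"
    by (simp add: fun_eq_iff response_covector_def u_vec_minus_s_vec_eq_duality_defect[OF K])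
  then have "span (response_covector \<sigma> \<kappa> K A f \<pi> ` {0<..<1}) =
      span ((\<lambda>\<gamma>. ?T (u_vec A f \<gamma>)) ` {0<..<1})"
    by (simp only: span_nonzero_scaled_image[of "{0<..<1}", OF denom])
  also have "\<dots> = ?T ` span (u_vec A f ` {0<..<1})"
    by (simp add: linear_span_image[OF linear_duality_defect, symmetric] image_image)
  also have "\<dots> = range ?T"
    by (simp add: span_u_vec[OF inj indep assms(6)])
  finally show ?thesis
    using assms(2) by (simp add: response_rank_def dim_range_duality_defect[OF skel])
qed

end
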